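(* Let $G$ and $H$ be connected graphs and $k\ge1$ an integer with $k\le\kappa(G)$, $|V(G)|\ge 2k-1$, and $\lambda(G)\ge (k-1)\lambda(H)$. (i) If $k|V(H)|\le |V(G)|\lambda(H)$ and $\mathrm{gon}(G)=k$, then $\mathrm{sn}(G\square H)=\mathrm{gon}(G\square H)=k|V(H)|$. (ii) If $|V(G)|\lambda(H)\le k|V(H)|$ and $\mathrm{gon}(H)=\lambda(H)$, then $\mathrm{sn}(G\square H)=\mathrm{gon}(G\square H)=|V(G)|\lambda(H)$.
   Context: Graphs are finite, multiple edges allowed, no loops. $\kappa$ is vertex-connectivity, $\lambda$ edge-connectivity (edges with multiplicity). $G\square H$ is the Cartesian product (vertex set $V(G)\times V(H)$; $(u_1,v_1),(u_2,v_2)$ joined by $e$ edges iff $u_1=u_2$ and $v_1,v_2$ joined by $e$ edges in $H$, or $v_1=v_2$ and $u_1,u_2$ joined by $e$ edges in $G$). Scramble number $\mathrm{sn}$: a scramble is a finite collection of nonempty vertex sets (eggs) each inducing a connected subgraph; its order is $\min(h,e)$ where $h$ is the minimum size of a vertex set meeting every egg and $e$ is the minimum of $|E(A,A^C)|$ over $A\subseteq V$ containing some egg whose complement contains some egg ($+\infty$ if none); $\mathrm{sn}$ is the maximum order. Gonality: a divisor is an integer combination of vertices; firing a vertex $w$ removes $\mathrm{val}(w)$ chips from $w$ and gives each other vertex one chip per edge to $w$; divisors are equivalent if related by firings; $D$ has positive rank if $D-(v)$ is equivalent to an effective divisor for every vertex $v$; $\mathrm{gon}$ is the minimum degree of a positive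 rank divisor. *)

theory Defs
  imports Main "HOL-Library.Extended_Nat"
begin

text \<open>
  Finite loopless multigraphs, given by a vertex set and the number of edges joining two vertices.
\<close>

record 'a mgraph =
  vertices :: "'a set"
  edge_mult :: "'a \<Rightarrow> 'a \<Rightarrow> nat"

definition multigraph :: "'a mgraph \<Rightarrow> bool" where
  "multigraph G \<longleftrightarrow>
     finite (vertices G) \<and>
     (\<forall>u v. edge_mult G u v = edge_mult G v u) \<and>
     (\<forall>v. edge_mult G v v = 0) \<and>
     (\<forall>u v. edge_mult G u v > 0 \<longrightarrow> u \<in> vertices G \<and> v \<in> vertices G)"

text \<open>The empty graph does not count as connected.\<close>

definition connected_graph :: "'a mgraph \<Rightarrow> bool" where
  "connected_graph G \<longleftrightarrow>
     vertices G \<noteq> {} \<and>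
     (\<forall>u\<in>vertices G. \<forall>v\<in>vertices G. (\<lambda>x y. edge_mult G x y > 0)\<^sup>*\<^sup>* u v)"

definition induced_graph :: "'a mgraph \<Rightarrow> 'a set \<Rightarrow> 'a mgraph" where
  "induced_graph G S =
     \<lparr>vertices = vertices G \<inter> S,
      edge_mult = (\<lambda>u v. if u \<in> S \<and> v \<in> S then edge_mult G u v else 0)\<rparr>"

definition cartesian_product :: "'a mgraph \<Rightarrow> 'b mgraph \<Rightarrow> ('a \<times> 'b) mgraph" where
  "cartesian_product G H =
     \<lparr>vertices = vertices G \<times> vertices H,
      edge_mult = (\<lambda>(u1, v1) (u2, v2).
        if u1 = u2 \<and> u1 \<in> vertices G then edge_mult H v1 v2
        else if v1 = v2 \<and> v1 \<in> vertices H then edge_mult G u1 u2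
        else 0)\<rparr>"

lemma multigraph_cartesian_product:
  assumes "multigraph G" "multigraph H"
  shows "multigraph (cartesian_product G H)"
  using assms unfolding multigraph_def cartesian_product_def
  by (auto split: if_splits)


text \<open>
  The least number of vertices whose deletion leaves a disconnected graph or a single vertex;
  complete graphs on \<open>n\<close> vertices (with any positive multiplicities) have connectivity \<open>n - 1\<close>.
\<close>

definition vertex_connectivity :: "'a mgraph \<Rightarrow> nat" where
  "vertex_connectivity G =
     (LEAST n. \<exists>X. X \<subset> vertices G \<and> card X = n \<and>
        (\<not> connected_graph (induced_graph G (vertices G - X)) \<or> card (vertices G - X) = 1))"

text \<open>Every edge is counted twice in the sum, once in each direction.\<close>

definition num_edges :: "'a mgraph \<Rightarrow> nat" where
  "num_edges G = (\<Sum>u\<in>vertices G. \<Sum>v\<in>vertices G. edge_mult G u v) div 2"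

definition spanning_subgraph :: "'a mgraph \<Rightarrow> 'a mgraph \<Rightarrow> bool" where
  "spanning_subgraph F G \<longleftrightarrow>
     multigraph F \<and> vertices F = vertices G \<and> (\<forall>u v. edge_mult F u v \<le> edge_mult G u v)"

definition delete_edges :: "'a mgraph \<Rightarrow> 'a mgraph \<Rightarrow> 'a mgraph" where
  "delete_edges G F =
     \<lparr>vertices = vertices G, edge_mult = (\<lambda>u v. edge_mult G u v - edge_mult F u v)\<rparr>"

text \<open>
  The least number of edges whose deletion disconnects the graph. A set of edges is represented by
  the spanning subgraph it forms. A graph with one vertex cannot be disconnected; its
  edge-connectivity is \<open>0\<close> by convention.
\<close>

definition edge_connectivity :: "'a mgraph \<Rightarrow> nat" where
  "edge_connectivity G =
     (if card (vertices G) = 1 then 0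
      else LEAST n. \<exists>F. spanning_subgraph F G \<and> num_edges F = n \<and>
                        \<not> connected_graph (delete_edges G F))"


definition scramble :: "'a mgraph \<Rightarrow> 'a set set \<Rightarrow> bool" where
  "scramble G S \<longleftrightarrow>
     finite S \<and>
     (\<forall>B\<in>S. B \<noteq> {} \<and> B \<subseteq> vertices G \<and> connected_graph (induced_graph G B))"

definition hitting_number :: "'a mgraph \<Rightarrow> 'a set set \<Rightarrow> enat" where
  "hitting_number G S =
     (INF X \<in> {X. X \<subseteq> vertices G \<and> (\<forall>B\<in>S. X \<inter> B \<noteq> {})}. enat (card X))"

definition cut_size :: "'a mgraph \<Rightarrow> 'a set \<Rightarrow> nat" where
  "cut_size G A = (\<Sum>u\<in>A. \<Sum>v\<in>vertices G - A. edge_mult G u v)"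

text \<open>The infimum of the empty set in \<^typ>\<open>enat\<close> is \<open>\<infinity>\<close>.\<close>

definition egg_cut_number :: "'a mgraph \<Rightarrow> 'a set set \<Rightarrow> enat" where
  "egg_cut_number G S =
     (INF A \<in> {A. A \<subseteq> vertices G \<and> (\<exists>B\<in>S. B \<subseteq> A) \<and> (\<exists>B\<in>S. B \<subseteq> vertices G - A)}.
        enat (cut_size G A))"

definition scramble_order :: "'a mgraph \<Rightarrow> 'a set set \<Rightarrow> enat" where
  "scramble_order G S = min (hitting_number G S) (egg_cut_number G S)"

definition scramble_number :: "'a mgraph \<Rightarrow> enat" where
  "scramble_number G = Max {scramble_order G S | S. scramble G S}"

text \<open>The maximum ranges over a finite nonempty set.\<close>

lemma scramble_orders_finite_nonempty:
  assumes "multigraph G"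
  shows "finite {scramble_order G S | S. scramble G S}"
    and "{scramble_order G S | S. scramble G S} \<noteq> {}"
proof -
  have "{S. scramble G S} \<subseteq> Pow (Pow (vertices G))"
    by (auto simp: scramble_def)
  then have "finite {S. scramble G S}"
    using assms by (meson finite_Pow_iff finite_subset multigraph_def)
  then show "finite {scramble_order G S | S. scramble G S}"
    by simp
  have "scramble G {}"
    by (simp add: scramble_def)
  then show "{scramble_order G S | S. scramble G S} \<noteq> {}"
    by blast
qed


text \<open>Divisors are integer-valued functions vanishing off the vertex set.\<close>

definition is_divisor :: "'a mgraph \<Rightarrow> ('a \<Rightarrow> int) \<Rightarrow> bool" where
  "is_divisor G D \<longleftrightarrow> (\<forall>v. v \<notin> vertices G \<longrightarrow> D v = 0)"

definition effective :: "'a mgraph \<Rightarrow> ('a \<Rightarrow> int) \<Rightarrow> bool" where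
  "effective G D \<longleftrightarrow> (\<forall>v\<in>vertices G. D v \<ge> 0)"

definition divisor_degree :: "'a mgraph \<Rightarrow> ('a \<Rightarrow> int) \<Rightarrow> int" where
  "divisor_degree G D = (\<Sum>v\<in>vertices G. D v)"

definition valence :: "'a mgraph \<Rightarrow> 'a \<Rightarrow> nat" where
  "valence G w = (\<Sum>v\<in>vertices G. edge_mult G w v)"

definition fire :: "'a mgraph \<Rightarrow> 'a \<Rightarrow> ('a \<Rightarrow> int) \<Rightarrow> ('a \<Rightarrow> int)" where
  "fire G w D =
     (\<lambda>v. if v = w then D v - int (valence G w) else D v + int (edge_mult G v w))"

definition divisor_equiv :: "'a mgraph \<Rightarrow> ('a \<Rightarrow> int) \<Rightarrow> ('a \<Rightarrow> int) \<Rightarrow> bool" where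
  "divisor_equiv G = equivclp (\<lambda>D D'. \<exists>w\<in>vertices G. D' = fire G w D)"

definition positive_rank :: "'a mgraph \<Rightarrow> ('a \<Rightarrow> int) \<Rightarrow> bool" where
  "positive_rank G D \<longleftrightarrow>
     is_divisor G D \<and>
     (\<forall>v\<in>vertices G. \<exists>E. is_divisor G E \<and> effective G E \<and> divisor_equiv G (D(v := D v - 1)) E)"

text \<open>
  Firing preserves the degree, so a divisor of positive rank on a nonempty graph has positive
  degree and it suffices to minimise over the natural numbers.
\<close>

definition gonality :: "'a mgraph \<Rightarrow> nat" where
  "gonality G = (LEAST n. \<exists>D. positive_rank G D \<and> divisor_degree G D = int n)"

end

theory Submission
  imports Defs
begin

text \<open>
  Gonality is at least the scramble number. A divisor of positive rank on one
  factor, repeated on all its copies, has positive rank on the product, which bounds the gonality of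
  \<open>G \<box> H\<close> by \<open>gon(G) |V(H)|\<close> and \<open>|V(G)| gon(H)\<close>. For the matching lower bound take as eggs the copies
  of \<open>G\<close> with \<open>k - 1\<close> vertices removed: a hitting set has at least \<open>k\<close> vertices in each copy, and
  a set separating two eggs splits almost all copies of \<open>H\<close>, each missing one being paid for by a
  split copy of \<open>G\<close>.
\<close>

section \<open>Divisors and the Laplacian\<close>

text \<open>The number \<open>c = k - 1\<close> of deleted vertices meets three constraints. Since
  \<open>c < \<kappa>(G)\<close>, every egg stays connected. Since \<open>|V(G)| >= 2k - 1\<close>,
  two eggs in the same row always meet, so separated eggs lie in different rows. Since
  \<open>\<lambda>(G) >= (k - 1) \<lambda>(H)\<close>, one split row can pay for up to
  \<open>c\<close> unsplit columns. Cases (i) and (ii) say which of the resulting bounds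
  \<open>k |V(H)|\<close> and \<open>|V(G)| \<lambda>(H)\<close> is the smaller one, and in each the
  gonality assumption on one factor makes the upper bound coincide with it. The obstacle in
  comparing scrambles with gonality is that single firings may pass through divisors that are not
  effective. Equivalence is therefore expressed by an integer firing script \<open>f\<close>, vertex
  \<open>v\<close> being fired \<open>f v\<close> times: it turns \<open>D\<close> into
  \<open>D - \<Delta>f\<close>, where \<open>\<Delta>f\<close> is the net outflow of chips. The
  order of the firings is then free.\<close>

definition laplacian :: "'a mgraph \<Rightarrow> ('a \<Rightarrow> int) \<Rightarrow> 'a \<Rightarrow> int" where
  "laplacian G f v = (\<Sum>u\<in>vertices G. int (edge_mult G v u) * (f v - f u))"

lemma multigraphD:
  assumes "multigraph G"
  shows "finite (vertices G)" "edge_mult G u v = edge_mult G v u" "edge_mult G v v = 0"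
    "u \<notin> vertices G \<Longrightarrow> edge_mult G u v = 0" "v \<notin> vertices G \<Longrightarrow> edge_mult G u v = 0"
  using assms unfolding multigraph_def by (blast, blast, blast, blast intro: gr_zeroI, blast intro: gr_zeroI)

lemma laplacian_outside: "multigraph G \<Longrightarrow> v \<notin> vertices G \<Longrightarrow> laplacian G f v = 0"
  by (simp add: laplacian_def multigraphD(4))

lemma laplacian_add: "laplacian G (\<lambda>v. f v + g v) v = laplacian G f v + laplacian G g v"
  by (simp add: laplacian_def sum.distrib[symmetric] algebra_simps)

lemma laplacian_diff: "laplacian G (\<lambda>v. f v - g v) v = laplacian G f v - laplacian G g v"
  by (simp add: laplacian_def sum_subtractf[symmetric] algebra_simps)

lemma laplacian_cmult: "laplacian G (\<lambda>v. c * f v) v = c * laplacian G f v"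
  by (simp add: laplacian_def sum_distrib_left algebra_simps)

lemma laplacian_const [simp]: "laplacian G (\<lambda>_. c) v = 0"
  by (simp add: laplacian_def)

lemma laplacian_cong:
  assumes "multigraph G" "\<And>v. v \<in> vertices G \<Longrightarrow> f v = g v"
  shows "laplacian G f = laplacian G g"
proof
  fix v show "laplacian G f v = laplacian G g v"
    using assms by (cases "v \<in> vertices G") (auto simp: laplacian_def multigraphD(4))
qed

text \<open>Chips are conserved: what leaves one end of an edge enters the other. Hence equivalent
  divisors have the same degree.\<close>

lemma sum_laplacian:
  assumes "multigraph G"
  shows "(\<Sum>v\<in>vertices G. laplacian G f v) = 0"
proof -
  let ?m = "\<lambda>u v. int (edge_mult G u v)"
  have "(\<Sum>v\<in>vertices G. \<Sum>u\<in>vertices G. ?m v u * f u)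
      = (\<Sum>u\<in>vertices G. \<Sum>v\<in>vertices G. ?m v u * f u)"
    by (rule sum.swap)
  also have "\<dots> = (\<Sum>v\<in>vertices G. \<Sum>u\<in>vertices G. ?m v u * f v)"
    by (intro sum.cong refl) (simp add: multigraphD(2)[OF assms])
  finally show ?thesis
    by (simp add: laplacian_def right_diff_distrib sum_subtractf)
qed

text \<open>When all of \<open>U\<close> fires once, exchanges inside \<open>U\<close> cancel, so
  \<open>v\<close> pays only for its edges leaving \<open>U\<close>.\<close>

lemma laplacian_indicator:
  assumes "multigraph G" "v \<in> U"
  shows "laplacian G (\<lambda>u. of_bool (u \<in> U)) v = int (\<Sum>u\<in>vertices G - U. edge_mult G v u)"
proof -
  have "laplacian G (\<lambda>u. of_bool (u \<in> U)) v
      = (\<Sum>u\<in>vertices G. if u \<in> U then 0 else int (edge_mult G v u))"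
    unfolding laplacian_def by (intro sum.cong refl) (use assms in auto)
  also have "\<dots> = (\<Sum>u\<in>vertices G - U. int (edge_mult G v u))"
    using multigraphD(1)[OF assms(1)] by (intro sum.mono_neutral_cong_right) auto
  finally show ?thesis by simp
qed

lemma laplacian_indicator_outside_le:
  assumes "multigraph G" "v \<notin> U" "u \<in> U"
  shows "laplacian G (\<lambda>u. of_bool (u \<in> U)) v \<le> - int (edge_mult G v u)"
proof (cases "u \<in> vertices G")
  case True
  have "laplacian G (\<lambda>u. of_bool (u \<in> U)) v
      = - (\<Sum>u\<in>vertices G. of_bool (u \<in> U) * int (edge_mult G v u))"
    unfolding laplacian_def sum_negf[symmetric] by (intro sum.cong refl) (use assms in auto)
  moreover have "int (edge_mult G v u) = of_bool (u \<in> U) * int (edge_mult G v u)"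
    using assms by simp
  moreover have "of_bool (u \<in> U) * int (edge_mult G v u)
      \<le> (\<Sum>u\<in>vertices G. of_bool (u \<in> U) * int (edge_mult G v u))"
    using multigraphD(1)[OF assms(1)] True by (intro member_le_sum) auto
  ultimately show ?thesis by linarith
next
  case False
  then have "edge_mult G v u = 0" using multigraphD(5)[OF assms(1)] by blast
  moreover have "laplacian G (\<lambda>u. of_bool (u \<in> U)) v \<le> 0"
    unfolding laplacian_def using assms(2) by (intro sum_nonpos) auto
  ultimately show ?thesis by simp
qed

lemma fire_eq_laplacian:
  assumes "multigraph G" "w \<in> vertices G"
  shows "fire G w D = (\<lambda>v. D v - laplacian G (\<lambda>u. of_bool (u = w)) v)"
proof
  fix v
  show "fire G w D v = D v - laplacian G (\<lambda>u. of_bool (u = w)) v"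
  proof (cases "v = w")
    case True
    have "valence G w = (\<Sum>u\<in>vertices G - {w}. edge_mult G w u)"
      unfolding valence_def using multigraphD(1,3)[OF assms(1)]
      by (intro sum.mono_neutral_right) auto
    then show ?thesis
      using True laplacian_indicator[OF assms(1), of v "{w}"] by (simp add: fire_def)
  next
    case False
    have "laplacian G (\<lambda>u. of_bool (u = w)) v
        = (\<Sum>u\<in>vertices G. if u = w then - int (edge_mult G v u) else 0)"
      unfolding laplacian_def by (intro sum.cong refl) (use False in auto)
    also have "\<dots> = - int (edge_mult G v w)"
      using multigraphD(1)[OF assms(1)] assms(2) by simp
    finally show ?thesis using False by (simp add: fire_def)
  qed
qed

section \<open>Equivalence of divisors in terms of firing scripts\<close>

lemma divisor_equiv_trans:
  "divisor_equiv G D E \<Longrightarrow> divisor_equiv G E F \<Longrightarrow> divisor_equiv G D F"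
  unfolding divisor_equiv_def by (rule equivclp_trans)

lemma divisor_equiv_laplacian_vertex:
  assumes "multigraph G" "w \<in> vertices G"
  shows "divisor_equiv G D (\<lambda>v. D v - laplacian G (\<lambda>u. c * of_bool (u = w)) v)"
proof -
  have *: "divisor_equiv G D (\<lambda>v. D v - laplacian G (\<lambda>u. int n * of_bool (u = w)) v)" for n D
  proof (induction n)
    case 0
    then show ?case by (simp add: divisor_equiv_def)
  next
    case (Suc n)
    let ?E = "\<lambda>v. D v - laplacian G (\<lambda>u. int n * of_bool (u = w)) v"
    have "divisor_equiv G ?E (fire G w ?E)"
      unfolding divisor_equiv_def using assms(2) by (intro r_into_equivclp) blast
    with Suc have "divisor_equiv G D (fire G w ?E)" by (rule divisor_equiv_trans)
    moreover have "fire G w ?E = (\<lambda>v. D v - laplacian G (\<lambda>u. int (Suc n) * of_bool (u = w)) v)"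
      unfolding fire_eq_laplacian[OF assms] laplacian_cmult by (intro ext) (simp add: algebra_simps)
    ultimately show ?case by (simp only:)
  qed
  show ?thesis
  proof (cases "c \<ge> 0")
    case True
    then show ?thesis using *[of D "nat c"] by (simp only: int_nat_eq if_True)
  next
    case False
    let ?E = "\<lambda>v. D v - laplacian G (\<lambda>u. c * of_bool (u = w)) v"
    have "int (nat (- c)) = - c" using False by simp
    then have "(\<lambda>v. ?E v - laplacian G (\<lambda>u. int (nat (- c)) * of_bool (u = w)) v) = D"
      unfolding laplacian_cmult by (intro ext) simp
    with *[of ?E "nat (- c)"] have "divisor_equiv G ?E D" by (simp only:)
    then show ?thesis unfolding divisor_equiv_def by (rule equivclp_sym)
  qed
qed

text \<open>Linearity of the Laplacian lets a chain of firings and reverse firings be recorded by a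
  script changing by 1 at one vertex per step. Conversely, a script is carried out vertex by vertex,
  negative values being reverse firings.\<close>

lemma divisor_equiv_iff_laplacian:
  assumes G: "multigraph G"
  shows "divisor_equiv G D E \<longleftrightarrow> (\<exists>f. E = (\<lambda>v. D v - laplacian G f v))"
proof
  assume "divisor_equiv G D E"
  then show "\<exists>f. E = (\<lambda>v. D v - laplacian G f v)"
    unfolding divisor_equiv_def
  proof (induction rule: equivclp_induct)
    case base
    have "D = (\<lambda>v. D v - laplacian G (\<lambda>_. 0) v)" by simp
    then show ?case by blast
  next
    case (step E E')
    obtain f where f: "E = (\<lambda>v. D v - laplacian G f v)" using step by blast
    obtain w where w: "w \<in> vertices G" "E' = fire G w E \<or> E = fire G w E'"
      using step(2) by blast
    have "E' = (\<lambda>v. D v - laplacian G (\<lambda>u. f u + of_bool (u = w)) v)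
        \<or> E' = (\<lambda>v. D v - laplacian G (\<lambda>u. f u - of_bool (u = w)) v)"
      using w(2) unfolding fire_eq_laplacian[OF G w(1)] f laplacian_add laplacian_diff
      by (auto simp: fun_eq_iff algebra_simps)
    then show ?case by blast
  qed
next
  assume "\<exists>f. E = (\<lambda>v. D v - laplacian G f v)"
  then obtain f where f: "E = (\<lambda>v. D v - laplacian G f v)" by blast
  have "divisor_equiv G D (\<lambda>v. D v - laplacian G (\<lambda>u. of_bool (u \<in> A) * f u) v)"
    if "finite A" "A \<subseteq> vertices G" for A
    using that
  proof (induction A rule: finite_induct)
    case empty
    then show ?case by (simp add: divisor_equiv_def)
  next
    case (insert w A)
    have "(\<lambda>u. of_bool (u \<in> insert w A) * f u)
        = (\<lambda>u. of_bool (u \<in> A) * f u + f w * of_bool (u = w))"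
      using insert by auto
    then have "(\<lambda>v. D v - laplacian G (\<lambda>u. of_bool (u \<in> insert w A) * f u) v)
      = (\<lambda>v. D v - laplacian G (\<lambda>u. of_bool (u \<in> A) * f u) v
              - laplacian G (\<lambda>u. f w * of_bool (u = w)) v)"
      by (simp only: laplacian_add) (simp add: algebra_simps)
    moreover have "divisor_equiv G D (\<lambda>v. D v - laplacian G (\<lambda>u. of_bool (u \<in> A) * f u) v)"
      using insert by blast
    then have "divisor_equiv G D (\<lambda>v. D v - laplacian G (\<lambda>u. of_bool (u \<in> A) * f u) v
              - laplacian G (\<lambda>u. f w * of_bool (u = w)) v)"
      by (rule divisor_equiv_trans) (use insert.prems divisor_equiv_laplacian_vertex[OF G] in blast)
    ultimately show ?case by (simp only:)
  qed
  from this[OF multigraphD(1)[OF G] subset_refl]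
  have "divisor_equiv G D (\<lambda>v. D v - laplacian G (\<lambda>u. of_bool (u \<in> vertices G) * f u) v)" .
  also have "laplacian G (\<lambda>u. of_bool (u \<in> vertices G) * f u) = laplacian G f"
    by (rule laplacian_cong[OF G]) simp
  finally show "divisor_equiv G D E" unfolding f .
qed

text \<open>The chip at \<open>v\<close> may be removed after the script instead of before it, so
  the same \<open>D\<close> can be used for all \<open>v\<close>.\<close>

lemma positive_rank_iff_laplacian:
  assumes G: "multigraph G"
  shows "positive_rank G D \<longleftrightarrow> is_divisor G D \<and>
    (\<forall>v\<in>vertices G. \<exists>f. (\<forall>w\<in>vertices G. D w - laplacian G f w \<ge> 0) \<and> D v - laplacian G f v \<ge> 1)"
proof -
  have "(\<exists>E. is_divisor G E \<and> effective G E \<and> divisor_equiv G (D(v := D v - 1)) E) \<longleftrightarrow>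
    (\<exists>f. (\<forall>w\<in>vertices G. D w - laplacian G f w \<ge> 0) \<and> D v - laplacian G f v \<ge> 1)"
    (is "?L \<longleftrightarrow> (\<exists>f. ?R f)")
    if D: "is_divisor G D" and v: "v \<in> vertices G" for v
  proof -
    have *: "is_divisor G (\<lambda>w. (D(v := D v - 1)) w - laplacian G f w)" for f
      using D v by (auto simp: is_divisor_def laplacian_outside[OF G])
    have "effective G (\<lambda>w. (D(v := D v - 1)) w - laplacian G f w) \<longleftrightarrow> ?R f" for f
    proof -
      have "(D(v := D v - 1)) w - laplacian G f w = D w - laplacian G f w - of_bool (w = v)" for w
        by simp
      then show ?thesis using v by (auto simp: effective_def of_bool_def split: if_splits)
    qed
    then show ?thesis
      unfolding divisor_equiv_iff_laplacian[OF G] using * by blast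
  qed
  then show ?thesis unfolding positive_rank_def by blast
qed

lemma positive_rank_if_ge_1:
  assumes "multigraph G" "is_divisor G D" "\<And>v. v \<in> vertices G \<Longrightarrow> D v \<ge> 1"
  shows "positive_rank G D"
proof -
  have "(\<forall>w\<in>vertices G. D w - laplacian G (\<lambda>_. 0) w \<ge> 0) \<and> D v - laplacian G (\<lambda>_. 0) v \<ge> 1"
    if "v \<in> vertices G" for v
    using assms(3) that by (auto intro: order_trans[OF zero_le_one])
  then show ?thesis
    unfolding positive_rank_iff_laplacian[OF assms(1)] using assms(2) by blast
qed

lemma gonality_attained:
  assumes G: "multigraph G"
  shows "\<exists>D. positive_rank G D \<and> divisor_degree G D = int (gonality G)"
proof -
  \<comment> \<open>One chip on every vertex shows that the \<open>LEAST\<close> in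
    \<open>gonality\<close> ranges over a nonempty set.\<close>
  let ?D = "\<lambda>v. of_bool (v \<in> vertices G) :: int"
  have "positive_rank G ?D"
    using G by (intro positive_rank_if_ge_1) (auto simp: is_divisor_def)
  moreover have "divisor_degree G ?D = int (card (vertices G))"
    by (simp add: divisor_degree_def)
  ultimately have "\<exists>n D. positive_rank G D \<and> divisor_degree G D = int n"
    by blast
  then show ?thesis
    unfolding gonality_def by (rule LeastI_ex)
qed

lemma gonality_le:
  "positive_rank G D \<Longrightarrow> divisor_degree G D = int n \<Longrightarrow> gonality G \<le> n"
  unfolding gonality_def by (intro Least_le) blast

section \<open>Scramble order and gonality\<close>

lemma laplacian_indicator_nonpos:
  "v \<notin> U \<Longrightarrow> laplacian G (\<lambda>u. of_bool (u \<in> U)) v \<le> 0"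
  unfolding laplacian_def by (intro sum_nonpos) auto

text \<open>Where \<open>t \<le> f v\<close>, truncation fixes the value at \<open>v\<close> and can
  only raise its neighbours, so the outflow does not grow. Where \<open>f v \<le> t\<close>, the
  truncated script is minimal at \<open>v\<close>, which then loses nothing. Together these keep all
  intermediate divisors effective.\<close>

lemma laplacian_max_le:
  assumes "t \<le> f v"
  shows "laplacian G (\<lambda>u. max (f u) t) v \<le> laplacian G f v"
  unfolding laplacian_def using assms by (intro sum_mono mult_left_mono) auto

lemma laplacian_max_nonpos:
  assumes "f v \<le> t"
  shows "laplacian G (\<lambda>u. max (f u) t) v \<le> 0"
  unfolding laplacian_def using assms by (intro sum_nonpos mult_nonneg_nonpos) auto

text \<open>As \<open>f\<close> is integer-valued, lowering the truncation level by 1 amounts, up to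
  a constant, to firing one superlevel set.\<close>

lemma laplacian_max_step:
  assumes "multigraph G"
  shows "laplacian G (\<lambda>u. max (f u) (t - 1)) v =
    laplacian G (\<lambda>u. max (f u) t) v
      + laplacian G (\<lambda>u. of_bool (u \<in> {u \<in> vertices G. t \<le> f u})) v"
proof -
  have "laplacian G (\<lambda>u. max (f u) (t - 1))
      = laplacian G (\<lambda>u. max (f u) t + of_bool (u \<in> {u \<in> vertices G. t \<le> f u}) - 1)"
    by (rule laplacian_cong[OF assms]) auto
  then show ?thesis by (simp only: laplacian_add laplacian_diff laplacian_const diff_0_right)
qed

lemma connected_induced_subset:
  assumes conn: "connected_graph (induced_graph G B)" and "B \<subseteq> vertices G"
    and "x \<in> B" "x \<in> U"
    and no_edge: "\<And>y z. y \<in> B \<Longrightarrow> y \<in> U \<Longrightarrow> z \<in> B \<Longrightarrow> z \<notin> U \<Longrightarrow> edge_mult G y z = 0"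
  shows "B \<subseteq> U"
proof
  fix z assume "z \<in> B"
  have "vertices (induced_graph G B) = B" using assms by (auto simp: induced_graph_def)
  with conn \<open>x \<in> B\<close> \<open>z \<in> B\<close>
  have "(\<lambda>x y. edge_mult (induced_graph G B) x y > 0)\<^sup>*\<^sup>* x z"
    by (simp only: connected_graph_def)
  then show "z \<in> U"
  proof (induction rule: rtranclp_induct)
    case (step y z)
    then show ?case using no_edge[of y z] by (auto simp: induced_graph_def split: if_splits)
  qed (rule assms)
qed

definition hit_eggs :: "'a set set \<Rightarrow> ('a \<Rightarrow> int) \<Rightarrow> 'a set set" where
  "hit_eggs S D = {B \<in> S. \<exists>v\<in>B. D v \<ge> 1}"

text \<open>
  Moving from \<open>D\<close> to \<open>D - \<Delta>f\<close> by firing the superlevel sets \<open>{t \<le> f}\<close> for decreasing \<open>t\<close> keeps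
  the divisor effective, as the divisor just before firing \<open>{t \<le> f}\<close> is \<open>D - \<Delta>(max f t)\<close>.
  Maximality of \<open>D\<close> forces some egg \<open>E'\<close> to lose its last chip before, or at the moment when, the
  egg \<open>E\<close> receives its first one; the set fired at that moment contains \<open>E'\<close> and avoids \<open>E\<close>.
\<close>

lemma egg_cut_le_degree:
  assumes G: "multigraph G" and S: "scramble G S"
    and eff: "\<And>w. w \<in> vertices G \<Longrightarrow> D w \<ge> 0"
    and max: "\<And>g. (\<forall>w\<in>vertices G. D w - laplacian G g w \<ge> 0) \<Longrightarrow>
      card (hit_eggs S (\<lambda>w. D w - laplacian G g w)) \<le> card (hit_eggs S D)"
    and E: "E \<in> S" "E \<notin> hit_eggs S D" and v: "v \<in> E"
    and f: "\<And>w. w \<in> vertices G \<Longrightarrow> D w - laplacian G f w \<ge> 0" "D v - laplacian G f v \<ge> 1"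
  shows "\<exists>A. A \<subseteq> vertices G \<and> (\<exists>B\<in>S. B \<subseteq> A) \<and> (\<exists>B\<in>S. B \<subseteq> vertices G - A) \<and>
    int (cut_size G A) \<le> divisor_degree G D"
proof -
  have finV: "finite (vertices G)" using multigraphD(1)[OF G] .
  have finS: "finite S" using S by (simp add: scramble_def)
  then have fin_hit: "finite (hit_eggs S D')" for D' by (simp add: hit_eggs_def)
  have eggV: "B \<subseteq> vertices G" and egg_conn: "connected_graph (induced_graph G B)"
    if "B \<in> S" for B using S that by (auto simp: scramble_def)
  have vV: "v \<in> vertices G" using eggV E v by blast
  define F where "F t w = D w - laplacian G (\<lambda>u. max (f u) t) w" for t w
  have Feff: "F t w \<ge> 0" if "w \<in> vertices G" for t w
  proof (cases "t \<le> f w")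
    case True
    then show ?thesis using f(1)[OF that] laplacian_max_le[of t f w G] by (simp add: F_def)
  next
    case False
    then show ?thesis using eff[OF that] laplacian_max_nonpos[of f w t G] by (simp add: F_def)
  qed
  define M where "M = Max (f ` vertices G)"
  define m where "m = Min (f ` vertices G)"
  have M: "f w \<le> M" and m: "m \<le> f w" if "w \<in> vertices G" for w
    using finV that by (auto simp: M_def m_def)
  have "laplacian G (\<lambda>u. max (f u) M) = laplacian G (\<lambda>_. M)"
    by (rule laplacian_cong[OF G]) (simp add: M max_absorb2)
  then have FM: "F M = D" by (simp add: F_def fun_eq_iff)
  have "laplacian G (\<lambda>u. max (f u) m) = laplacian G f"
    by (rule laplacian_cong[OF G]) (simp add: m max_absorb1)
  then have Fm: "F m = (\<lambda>w. D w - laplacian G f w)" by (simp add: F_def fun_eq_iff)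
  \<comment> \<open>Each \<open>F t\<close> is effective and equivalent to \<open>D\<close>, so
    maximality applies to it: it cannot keep all hit eggs of \<open>D\<close> and gain
    another.\<close>
  have card_le: "card (hit_eggs S (F t)) \<le> card (hit_eggs S D)" for t
    using max[of "\<lambda>u. max (f u) t"] Feff[of _ t] by (simp add: F_def[abs_def])
  have hit_eq: "hit_eggs S (F t) = hit_eggs S D" if "hit_eggs S D \<subseteq> hit_eggs S (F t)" for t
    using card_seteq[OF fin_hit that card_le] by simp
  have "E \<in> hit_eggs S (F m)"
    using E(1) v f(2) unfolding hit_eggs_def Fm by blast
  then have not_m: "\<not> hit_eggs S D \<subseteq> hit_eggs S (F m)"
    using hit_eq[of m] E(2) by blast
  \<comment> \<open>Levels descend by 1 from \<open>M\<close>, where \<open>F M = D\<close>, to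
    \<open>m\<close>, where the script \<open>f\<close> is complete. The level chosen is the last
    one before the first loss of a hit egg; the double negations match the form of
    \<open>ex_least_nat_less\<close>.\<close>
  have "M - int (nat (M - m)) = m" using M[OF vV] m[OF vV] by simp
  with not_m have "\<not> hit_eggs S D \<subseteq> hit_eggs S (F (M - int (nat (M - m))))"
    by (simp only: not_False_eq_True)
  moreover have "\<not> \<not> hit_eggs S D \<subseteq> hit_eggs S (F (M - int 0))"
    by (simp add: FM)
  ultimately obtain i where i: "\<not> \<not> hit_eggs S D \<subseteq> hit_eggs S (F (M - int i))"
    "\<not> hit_eggs S D \<subseteq> hit_eggs S (F (M - int (Suc i)))"
    using ex_least_nat_less[of "\<lambda>i. \<not> hit_eggs S D \<subseteq> hit_eggs S (F (M - int i))" "nat (M - m)"]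
    by blast
  define t where "t = M - int i"
  have Ft: "hit_eggs S (F t) = hit_eggs S D" using i(1) hit_eq unfolding t_def by blast
  have "M - int (Suc i) = t - 1" by (simp add: t_def)
  with i(2) have "\<not> hit_eggs S (F t) \<subseteq> hit_eggs S (F (t - 1))" by (simp only: Ft not_False_eq_True)
  then obtain E' where E': "E' \<in> hit_eggs S (F t)" "E' \<notin> hit_eggs S (F (t - 1))"
    by blast
  define U where "U = {u \<in> vertices G. t \<le> f u}"
  let ?l = "laplacian G (\<lambda>u. of_bool (u \<in> U))"
  have UV: "U \<subseteq> vertices G" by (auto simp: U_def)
  have F_step: "F (t - 1) w = F t w - ?l w" for w
    unfolding F_def laplacian_max_step[OF G] U_def by simp
  have E'S: "E' \<in> S" using E' by (simp add: hit_eggs_def)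
  \<comment> \<open>\<open>E'\<close> is left without chips by the firing of \<open>U\<close>. So
    its vertex \<open>x\<close> that had a chip was fired, and an edge from a fired to an unfired
    vertex of \<open>E'\<close> would have delivered a chip.\<close>
  have "E' \<subseteq> U"
  proof -
    obtain x where x: "x \<in> E'" "F t x \<ge> 1" using E' by (auto simp: hit_eggs_def)
    have F0: "F (t - 1) w \<le> 0" if "w \<in> E'" for w
      using E'(2) E'S that by (force simp: hit_eggs_def)
    have "x \<in> U"
      using F0[OF x(1)] x(2) F_step[of x] laplacian_indicator_nonpos[of x U G] by force
    show ?thesis
    proof (rule connected_induced_subset[OF egg_conn[OF E'S] eggV[OF E'S] x(1) \<open>x \<in> U\<close>])
      fix y z assume yz: "y \<in> E'" "y \<in> U" "z \<in> E'" "z \<notin> U"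
      have "F t z \<ge> 0" using Feff yz eggV[OF E'S] by blast
      then have "int (edge_mult G z y) \<le> 0"
        using F0[OF yz(3)] F_step[of z] laplacian_indicator_outside_le[OF G yz(4,2)] by linarith
      then show "edge_mult G y z = 0" using multigraphD(2)[OF G, of y z] by simp
    qed
  qed
  \<comment> \<open>\<open>E\<close> has no chips before the firing, so its vertices in
    \<open>U\<close> cannot pay for any edge leaving \<open>U\<close>. If there are such vertices,
    connectedness puts all of \<open>E\<close> into \<open>U\<close>.\<close>
  moreover have "E \<subseteq> vertices G - U"
  proof (rule ccontr)
    assume "\<not> E \<subseteq> vertices G - U"
    then obtain x where x: "x \<in> E" "x \<in> U" using eggV[OF E(1)] by blast
    have "E \<notin> hit_eggs S (F t)" using E(2) Ft by simp
    then have F0: "F t w \<le> 0" if "w \<in> E" for w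
      using E(1) that by (force simp: hit_eggs_def)
    have "E \<subseteq> U"
    proof (rule connected_induced_subset[OF egg_conn[OF E(1)] eggV[OF E(1)] x])
      fix y z assume yz: "y \<in> E" "y \<in> U" "z \<in> E" "z \<notin> U"
      then have "F (t - 1) y \<ge> 0" using Feff UV by blast
      then have "?l y \<le> 0" using F0[OF yz(1)] F_step[of y] by linarith
      then have "(\<Sum>u\<in>vertices G - U. edge_mult G y u) = 0"
        by (simp only: laplacian_indicator[OF G yz(2)] of_nat_le_0_iff)
      then have "\<forall>u\<in>vertices G - U. edge_mult G y u = 0" using finV by simp
      then show "edge_mult G y z = 0" using yz(3,4) eggV[OF E(1)] by blast
    qed
    \<comment> \<open>At a vertex of \<open>U\<close> the descent below level \<open>t\<close> never
      adds chips, so \<open>v\<close> would already have one in \<open>F t\<close>.\<close>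
    then have "t \<le> f v" using v by (auto simp: U_def)
    then have "D v - laplacian G f v \<le> F t v"
      using laplacian_max_le[of t f v G] by (simp add: F_def)
    then show False using F0[OF v] f(2) by linarith
  qed
  \<comment> \<open>The divisor remains effective after firing \<open>U\<close>, so the chips on
    \<open>U\<close> beforehand cover every edge of the cut.\<close>
  moreover have "int (cut_size G U) \<le> divisor_degree G D"
  proof -
    have "int (cut_size G U) = (\<Sum>u\<in>U. ?l u)"
      unfolding cut_size_def of_nat_sum[of _ U]
      by (intro sum.cong refl) (simp only: laplacian_indicator[OF G])
    also have "\<dots> \<le> (\<Sum>u\<in>U. F t u)"
    proof (rule sum_mono)
      fix u assume "u \<in> U"
      then have "F (t - 1) u \<ge> 0" using Feff UV by blast
      then show "?l u \<le> F t u" using F_step[of u] by linarith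
    qed
    also have "\<dots> \<le> (\<Sum>u\<in>vertices G. F t u)"
      using finV UV Feff by (intro sum_mono2) auto
    also have "\<dots> = divisor_degree G D"
      by (simp add: F_def sum_subtractf sum_laplacian[OF G] divisor_degree_def)
    finally show ?thesis .
  qed
  ultimately show ?thesis using UV E(1) E'S by blast
qed

text \<open>If every egg holds a chip, the support of \<open>D\<close> is a hitting set, and an
  effective divisor has at most as many support vertices as chips.\<close>

lemma hitting_number_le_degree:
  assumes G: "multigraph G"
    and eff: "\<And>w. w \<in> vertices G \<Longrightarrow> D w \<ge> 0"
    and S: "\<Union>S \<subseteq> vertices G" "hit_eggs S D = S"
    and n: "divisor_degree G D = int n"
  shows "hitting_number G S \<le> enat n"
proof -
  let ?X = "{w \<in> vertices G. D w \<ge> 1}"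
  have finV: "finite (vertices G)" using multigraphD(1)[OF G] .
  have "int (card ?X) = (\<Sum>w\<in>?X. 1)" by simp
  also have "\<dots> \<le> (\<Sum>w\<in>?X. D w)" by (intro sum_mono) auto
  also have "\<dots> \<le> divisor_degree G D"
    unfolding divisor_degree_def using finV eff by (intro sum_mono2) auto
  finally have "card ?X \<le> n" using n by simp
  moreover have "?X \<inter> B \<noteq> {}" if "B \<in> S" for B
  proof -
    have "B \<in> hit_eggs S D" using that S(2) by simp
    then obtain v where "v \<in> B" "D v \<ge> 1" by (auto simp: hit_eggs_def)
    then show ?thesis using S(1) that by blast
  qed
  then have "hitting_number G S \<le> enat (card ?X)"
    unfolding hitting_number_def by (intro INF_lower) blast
  ultimately show ?thesis by (meson enat_ord_simps(1) order_trans)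
qed

theorem scramble_order_le_degree:
  assumes G: "multigraph G" and ne: "vertices G \<noteq> {}" and S: "scramble G S"
    and D: "positive_rank G D" and n: "divisor_degree G D = int n"
  shows "scramble_order G S \<le> enat n"
proof -
  define Eff where "Eff g \<longleftrightarrow> (\<forall>w\<in>vertices G. D w - laplacian G g w \<ge> 0)" for g
  define hits where "hits g = card (hit_eggs S (\<lambda>w. D w - laplacian G g w))" for g
  have finS: "finite S" using S by (simp add: scramble_def)
  have rank: "\<exists>f. Eff f \<and> D v - laplacian G f v \<ge> 1" if "v \<in> vertices G" for v
    using D that unfolding positive_rank_iff_laplacian[OF G] Eff_def by blast
  then obtain f0 where "Eff f0" using ne by blast
  moreover have "\<forall>g. Eff g \<longrightarrow> hits g \<le> card S"
    unfolding hits_def hit_eggs_def using finS by (auto intro: card_mono)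
  \<comment> \<open>Among the effective divisors equivalent to \<open>D\<close>, take one putting
    chips on as many eggs as possible. Either it reaches all of them and bounds the hitting number,
    or a missed egg yields a small cut.\<close>
  ultimately obtain g where g: "Eff g" "\<And>h. Eff h \<Longrightarrow> hits h \<le> hits g"
    using ex_has_greatest_nat[of Eff f0 hits "Suc (card S)"] by (metis less_Suc_eq_le)
  let ?D = "\<lambda>w. D w - laplacian G g w"
  have deg: "divisor_degree G ?D = int n"
    using n by (simp add: divisor_degree_def sum_subtractf sum_laplacian[OF G])
  have shift: "?D w - laplacian G h w = D w - laplacian G (\<lambda>u. g u + h u) w" for h w
    by (simp add: laplacian_add)
  show ?thesis
  proof (cases "hit_eggs S ?D = S")
    case True
    then have "hitting_number G S \<le> enat n"
      using hitting_number_le_degree[OF G _ _ True deg] g(1) S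
      by (auto simp: Eff_def scramble_def)
    then show ?thesis by (simp add: scramble_order_def min.coboundedI1)
  next
    case False
    then obtain E where E: "E \<in> S" "E \<notin> hit_eggs S ?D" by (auto simp: hit_eggs_def)
    obtain v where v: "v \<in> E" "v \<in> vertices G" using S E by (fastforce simp: scramble_def)
    obtain f where f: "Eff f" "D v - laplacian G f v \<ge> 1" using rank v by blast
    \<comment> \<open>The script \<open>f - g\<close> leads from the maximal divisor to the one with
      a chip at \<open>v\<close>.\<close>
    have f': "?D w - laplacian G (\<lambda>u. f u - g u) w = D w - laplacian G f w" for w
      by (simp add: laplacian_diff)
    have "\<exists>A. A \<subseteq> vertices G \<and> (\<exists>B\<in>S. B \<subseteq> A) \<and> (\<exists>B\<in>S. B \<subseteq> vertices G - A) \<and>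
        int (cut_size G A) \<le> divisor_degree G ?D"
    proof (rule egg_cut_le_degree[OF G S _ _ E v(1), where f = "\<lambda>u. f u - g u"])
      show "?D w \<ge> 0" if "w \<in> vertices G" for w using g(1) that by (simp add: Eff_def)
      show "card (hit_eggs S (\<lambda>w. ?D w - laplacian G h w)) \<le> card (hit_eggs S ?D)"
        if "\<forall>w\<in>vertices G. ?D w - laplacian G h w \<ge> 0" for h
        using g(2)[of "\<lambda>u. g u + h u"] that unfolding shift Eff_def hits_def by blast
    qed (use f in \<open>auto simp: f' Eff_def\<close>)
    then obtain A where A: "A \<subseteq> vertices G" "\<exists>B\<in>S. B \<subseteq> A" "\<exists>B\<in>S. B \<subseteq> vertices G - A"
      "cut_size G A \<le> n" unfolding deg by auto
    then have "egg_cut_number G S \<le> enat (cut_size G A)"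
      unfolding egg_cut_number_def by (intro INF_lower) auto
    also have "\<dots> \<le> enat n" using A by simp
    finally show ?thesis by (simp add: scramble_order_def min.coboundedI2)
  qed
qed

corollary scramble_number_le_gonality:
  assumes G: "multigraph G" and ne: "vertices G \<noteq> {}"
  shows "scramble_number G \<le> enat (gonality G)"
proof -
  obtain D where "positive_rank G D" "divisor_degree G D = int (gonality G)"
    using gonality_attained[OF G] by blast
  then show ?thesis
    unfolding scramble_number_def
    using scramble_orders_finite_nonempty[OF G] scramble_order_le_degree[OF G ne]
    by (subst Max_le_iff) auto
qed

section \<open>Cartesian products\<close>

lemma vertices_cartesian_product [simp]:
  "vertices (cartesian_product G H) = vertices G \<times> vertices H"
  by (simp add: cartesian_product_def)

text \<open>The nested cases become a sum, because looplessness makes both terms vanish when the two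
  vertices coincide.\<close>

lemma edge_mult_cartesian_product:
  assumes "multigraph G" "multigraph H" "u1 \<in> vertices G" "v1 \<in> vertices H"
  shows "edge_mult (cartesian_product G H) (u1, v1) (u2, v2) =
    (if u2 = u1 then edge_mult H v1 v2 else 0) + (if v2 = v1 then edge_mult G u1 u2 else 0)"
  using assms(3,4) by (simp add: cartesian_product_def multigraphD(3)[OF assms(1)]
    multigraphD(3)[OF assms(2)])

text \<open>The weight \<open>g\<close> and the general semiring serve both the integer Laplacian
  and the natural-number cut sizes.\<close>

lemma sum_edge_mult_cartesian_product:
  fixes g :: "'a \<times> 'b \<Rightarrow> 'c::comm_semiring_1"
  assumes G: "multigraph G" and H: "multigraph H" and u: "u \<in> vertices G" and v: "v \<in> vertices H"
  shows "(\<Sum>q\<in>vertices G \<times> vertices H. of_nat (edge_mult (cartesian_product G H) (u, v) q) * g q) =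
    (\<Sum>y\<in>vertices H. of_nat (edge_mult H v y) * g (u, y)) +
    (\<Sum>x\<in>vertices G. of_nat (edge_mult G u x) * g (x, v))"
proof -
  have fin: "finite (vertices G)" "finite (vertices H)" using G H by (auto intro: multigraphD(1))
  have "(\<Sum>q\<in>vertices G \<times> vertices H. of_nat (edge_mult (cartesian_product G H) (u, v) q) * g q)
    = (\<Sum>x\<in>vertices G. \<Sum>y\<in>vertices H.
        (if x = u then of_nat (edge_mult H v y) * g (u, y) else 0) +
        (if y = v then of_nat (edge_mult G u x) * g (x, v) else 0))"
    unfolding sum.cartesian_product'
    by (intro sum.cong refl)
      (auto simp: edge_mult_cartesian_product[OF G H u v] distrib_right)
  also have "\<dots> = (\<Sum>x\<in>vertices G. \<Sum>y\<in>vertices H.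
          if x = u then of_nat (edge_mult H v y) * g (u, y) else 0) +
      (\<Sum>x\<in>vertices G. \<Sum>y\<in>vertices H.
          if y = v then of_nat (edge_mult G u x) * g (x, v) else 0)"
    by (simp only: sum.distrib)
  also have "(\<Sum>x\<in>vertices G. \<Sum>y\<in>vertices H.
          if x = u then of_nat (edge_mult H v y) * g (u, y) else 0) =
      (\<Sum>y\<in>vertices H. of_nat (edge_mult H v y) * g (u, y))"
    by (subst sum.swap) (simp add: fin u)
  also have "(\<Sum>x\<in>vertices G. \<Sum>y\<in>vertices H.
          if y = v then of_nat (edge_mult G u x) * g (x, v) else 0) =
      (\<Sum>x\<in>vertices G. of_nat (edge_mult G u x) * g (x, v))"
    by (simp add: fin v)
  finally show ?thesis .
qed

lemma laplacian_cartesian_product: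
  assumes "multigraph G" "multigraph H" "u \<in> vertices G" "v \<in> vertices H"
  shows "laplacian (cartesian_product G H) f (u, v) =
    laplacian H (\<lambda>y. f (u, y)) v + laplacian G (\<lambda>x. f (x, v)) u"
  using sum_edge_mult_cartesian_product[OF assms, where g = "\<lambda>q. f (u, v) - f q"]
  by (simp add: laplacian_def)

section \<open>Upper bounds on the gonality of a product\<close>

lemma gonality_cartesian_product_le_left:
  assumes G: "multigraph G" and H: "multigraph H"
  shows "gonality (cartesian_product G H) \<le> gonality G * card (vertices H)"
proof -
  obtain D where D: "positive_rank G D" "divisor_degree G D = int (gonality G)"
    using gonality_attained[OF G] by blast
  let ?P = "cartesian_product G H"
  let ?D = "\<lambda>(u, v). if v \<in> vertices H then D u else 0"
  \<comment> \<open>A script depending only on the first coordinate is constant on columns, so chips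
    move only along rows, in each of them as on \<open>G\<close>.\<close>
  have lap: "laplacian ?P (\<lambda>(u, v). f u) (x, y) = laplacian G f x"
    if "x \<in> vertices G" "y \<in> vertices H" for f x y
    using that by (simp add: laplacian_cartesian_product[OF G H])
  have "positive_rank ?P ?D"
    unfolding positive_rank_iff_laplacian[OF multigraph_cartesian_product[OF G H]]
  proof (intro conjI ballI)
    show "is_divisor ?P ?D"
      using D(1) by (auto simp: is_divisor_def positive_rank_def)
    fix p assume "p \<in> vertices ?P"
    then obtain u v where p: "p = (u, v)" "u \<in> vertices G" "v \<in> vertices H" by auto
    then obtain f where f: "\<forall>w\<in>vertices G. D w - laplacian G f w \<ge> 0" "D u - laplacian G f u \<ge> 1"
      using D(1) unfolding positive_rank_iff_laplacian[OF G] by blast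
    show "\<exists>f. (\<forall>w\<in>vertices ?P. ?D w - laplacian ?P f w \<ge> 0) \<and> ?D p - laplacian ?P f p \<ge> 1"
      by (rule exI[of _ "\<lambda>(u, v). f u"]) (use f p in \<open>auto simp: lap\<close>)
  qed
  moreover have "divisor_degree ?P ?D = int (gonality G * card (vertices H))"
    using D(2) by (simp add: divisor_degree_def sum.cartesian_product'
      sum_distrib_left[symmetric])
  ultimately show ?thesis by (rule gonality_le)
qed

lemma gonality_cartesian_product_le_right:
  assumes G: "multigraph G" and H: "multigraph H"
  shows "gonality (cartesian_product G H) \<le> card (vertices G) * gonality H"
proof -
  obtain D where D: "positive_rank H D" "divisor_degree H D = int (gonality H)"
    using gonality_attained[OF H] by blast
  let ?P = "cartesian_product G H"
  let ?D = "\<lambda>(u, v). if u \<in> vertices G then D v else 0"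
  have lap: "laplacian ?P (\<lambda>(u, v). f v) (x, y) = laplacian H f y"
    if "x \<in> vertices G" "y \<in> vertices H" for f x y
    using that by (simp add: laplacian_cartesian_product[OF G H])
  have "positive_rank ?P ?D"
    unfolding positive_rank_iff_laplacian[OF multigraph_cartesian_product[OF G H]]
  proof (intro conjI ballI)
    show "is_divisor ?P ?D"
      using D(1) by (auto simp: is_divisor_def positive_rank_def)
    fix p assume "p \<in> vertices ?P"
    then obtain u v where p: "p = (u, v)" "u \<in> vertices G" "v \<in> vertices H" by auto
    then obtain f where f: "\<forall>w\<in>vertices H. D w - laplacian H f w \<ge> 0" "D v - laplacian H f v \<ge> 1"
      using D(1) unfolding positive_rank_iff_laplacian[OF H] by blast
    show "\<exists>f. (\<forall>w\<in>vertices ?P. ?D w - laplacian ?P f w \<ge> 0) \<and> ?D p - laplacian ?P f p \<ge> 1"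
      by (rule exI[of _ "\<lambda>(u, v). f v"]) (use f p in \<open>auto simp: lap\<close>)
  qed
  moreover have "divisor_degree ?P ?D = int (card (vertices G) * gonality H)"
    using D(2) by (simp add: divisor_degree_def sum.cartesian_product')
  ultimately show ?thesis by (rule gonality_le)
qed

section \<open>Edge cuts of a product\<close>

lemma cut_size_eq_sum_of_bool:
  assumes "multigraph G"
  shows "cut_size G (vertices G \<inter> A) =
    (\<Sum>u\<in>vertices G. \<Sum>v\<in>vertices G. edge_mult G u v * of_bool (u \<in> A \<and> v \<notin> A))"
proof -
  have fin: "finite (vertices G)" using multigraphD(1)[OF assms] .
  \<comment> \<open>Extending both sums to all of \<open>vertices G\<close> frees their ranges from
    \<open>A\<close>, so that product sums can be split and swapped.\<close>
  have "cut_size G (vertices G \<inter> A) = (\<Sum>u\<in>vertices G \<inter> A. \<Sum>v\<in>vertices G.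
      edge_mult G u v * of_bool (u \<in> A \<and> v \<notin> A))"
    unfolding cut_size_def
    by (intro sum.cong refl sum.mono_neutral_cong_left fin) auto
  also have "\<dots> = (\<Sum>u\<in>vertices G. \<Sum>v\<in>vertices G. edge_mult G u v * of_bool (u \<in> A \<and> v \<notin> A))"
    by (rule sum.mono_neutral_left[OF fin]) auto
  finally show ?thesis .
qed

lemma cut_size_cartesian_product:
  assumes G: "multigraph G" and H: "multigraph H" and A: "A \<subseteq> vertices G \<times> vertices H"
  shows "cut_size (cartesian_product G H) A =
    (\<Sum>u\<in>vertices G. cut_size H (vertices H \<inter> {v. (u, v) \<in> A})) +
    (\<Sum>v\<in>vertices H. cut_size G (vertices G \<inter> {u. (u, v) \<in> A}))"
proof -
  let ?P = "cartesian_product G H"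
  have "cut_size ?P A = cut_size ?P (vertices ?P \<inter> A)"
    using A by (simp add: Int_absorb1)
  also have "\<dots> = (\<Sum>u\<in>vertices G. \<Sum>v\<in>vertices H. \<Sum>q\<in>vertices G \<times> vertices H.
      of_nat (edge_mult ?P (u, v) q) * of_bool ((u, v) \<in> A \<and> q \<notin> A))"
    unfolding cut_size_eq_sum_of_bool[OF multigraph_cartesian_product[OF G H]]
    by (subst vertices_cartesian_product, subst sum.cartesian_product') simp
  also have "\<dots> = (\<Sum>u\<in>vertices G. \<Sum>v\<in>vertices H.
      (\<Sum>y\<in>vertices H. edge_mult H v y * of_bool ((u, v) \<in> A \<and> (u, y) \<notin> A)) +
      (\<Sum>x\<in>vertices G. edge_mult G u x * of_bool ((u, v) \<in> A \<and> (x, v) \<notin> A)))"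
    by (intro sum.cong refl, subst sum_edge_mult_cartesian_product[OF G H]) simp_all
  also have "\<dots> = (\<Sum>u\<in>vertices G. cut_size H (vertices H \<inter> {v. (u, v) \<in> A})) +
    (\<Sum>u\<in>vertices G. \<Sum>v\<in>vertices H.
      (\<Sum>x\<in>vertices G. edge_mult G u x * of_bool ((u, v) \<in> A \<and> (x, v) \<notin> A)))"
    by (simp add: sum.distrib cut_size_eq_sum_of_bool[OF H])
  also have "(\<Sum>u\<in>vertices G. \<Sum>v\<in>vertices H.
      (\<Sum>x\<in>vertices G. edge_mult G u x * of_bool ((u, v) \<in> A \<and> (x, v) \<notin> A))) =
    (\<Sum>v\<in>vertices H. cut_size G (vertices G \<inter> {u. (u, v) \<in> A}))"
    by (subst sum.swap) (simp add: cut_size_eq_sum_of_bool[OF G])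
  finally show ?thesis .
qed

section \<open>Connectivity\<close>

lemma edge_connectivity_le_cut_size:
  assumes G: "multigraph G" and A: "A \<subset> vertices G" "A \<noteq> {}"
  shows "edge_connectivity G \<le> cut_size G A"
proof -
  define F where "F = \<lparr>vertices = vertices G, edge_mult = (\<lambda>u v.
    if u \<in> vertices G \<and> v \<in> vertices G \<and> (u \<in> A) \<noteq> (v \<in> A) then edge_mult G u v else 0)\<rparr>"
  have "spanning_subgraph F G"
    using G by (auto simp: spanning_subgraph_def multigraph_def F_def split: if_splits)
  moreover have "num_edges F = cut_size G A"
  proof -
    let ?s = "\<lambda>u v. edge_mult G u v * of_bool (u \<in> A \<and> v \<notin> A)"
    have "(\<Sum>u\<in>vertices F. \<Sum>v\<in>vertices F. edge_mult F u v)
        = (\<Sum>u\<in>vertices G. \<Sum>v\<in>vertices G. ?s u v + ?s v u)"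
      using multigraphD(2)[OF G] by (intro sum.cong) (auto simp: F_def)
    also have "\<dots> = (\<Sum>u\<in>vertices G. \<Sum>v\<in>vertices G. ?s u v) + (\<Sum>u\<in>vertices G. \<Sum>v\<in>vertices G. ?s v u)"
      by (simp only: sum.distrib)
    also have "(\<Sum>u\<in>vertices G. \<Sum>v\<in>vertices G. ?s v u) = (\<Sum>u\<in>vertices G. \<Sum>v\<in>vertices G. ?s u v)"
      by (rule sum.swap)
    also have "(\<Sum>u\<in>vertices G. \<Sum>v\<in>vertices G. ?s u v) = cut_size G A"
      using cut_size_eq_sum_of_bool[OF G, of A] A(1) by (simp add: Int_absorb1 psubset_imp_subset)
    finally show ?thesis by (simp add: num_edges_def)
  qed
  moreover have "\<not> connected_graph (delete_edges G F)"
  proof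
    assume conn: "connected_graph (delete_edges G F)"
    obtain x y where xy: "x \<in> A" "y \<in> vertices G" "y \<notin> A" using A by blast
    have "(\<lambda>x y. edge_mult (delete_edges G F) x y > 0)\<^sup>*\<^sup>* x y"
      using conn xy A(1) unfolding connected_graph_def by (auto simp: delete_edges_def)
    then have "y \<in> A"
    proof (induction rule: rtranclp_induct)
      case (step y z)
      have e: "edge_mult G y z - edge_mult F y z > 0" using step(2) by (simp add: delete_edges_def)
      then have "y \<in> vertices G" "z \<in> vertices G" using multigraphD(4,5)[OF G] by fastforce+
      then show ?case using e step.IH by (auto simp: F_def split: if_splits)
    qed (rule xy)
    then show False using xy by blast
  qed
  ultimately have "(LEAST n. \<exists>F. spanning_subgraph F G \<and> num_edges F = n \<and>
      \<not> connected_graph (delete_edges G F)) \<le> cut_size G A"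
    by (intro Least_le) blast
  \<comment> \<open>A nonempty proper vertex set rules out the one-vertex convention.\<close>
  moreover have "card (vertices G) \<noteq> 1" using A by (auto simp: card_1_singleton_iff)
  ultimately show ?thesis by (simp add: edge_connectivity_def)
qed

lemma connected_delete_vertices:
  assumes "X \<subset> vertices G" "card X < vertex_connectivity G"
  shows "connected_graph (induced_graph G (vertices G - X))"
  using assms not_less_Least[of "card X"] unfolding vertex_connectivity_def by blast

lemma connected_induced_row:
  assumes G: "multigraph G" and H: "multigraph H" and v: "v \<in> vertices H"
    and B: "B \<subseteq> vertices G" "connected_graph (induced_graph G B)"
  shows "connected_graph (induced_graph (cartesian_product G H) (B \<times> {v}))"
proof -
  let ?I = "induced_graph (cartesian_product G H) (B \<times> {v})"
  have path: "(\<lambda>p q. edge_mult ?I p q > 0)\<^sup>*\<^sup>* (x, v) (y, v)"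
    if "(\<lambda>x y. edge_mult (induced_graph G B) x y > 0)\<^sup>*\<^sup>* x y" for x y
    using that
  proof (induction rule: rtranclp_induct)
    case (step y z)
    then have yz: "y \<in> B" "z \<in> B" "edge_mult G y z > 0"
      by (auto simp: induced_graph_def split: if_splits)
    then have "edge_mult ?I (y, v) (z, v) > 0"
      using B(1) by (auto simp: induced_graph_def edge_mult_cartesian_product[OF G H _ v])
    with step.IH show ?case by (rule rtranclp.rtrancl_into_rtrancl)
  qed simp
  have "vertices ?I = B \<times> {v}" using B v by (auto simp: induced_graph_def)
  moreover have "vertices (induced_graph G B) = B" using B by (auto simp: induced_graph_def)
  ultimately show ?thesis
    using B(2) path unfolding connected_graph_def by auto
qed

section \<open>A scramble on the product\<close>

text \<open>
  The columns \<open>{u} \<times> V(H)\<close> that \<open>A\<close> does not split are paid for by the rows \<open>V(G) \<times> {v}\<close> and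
  \<open>V(G) \<times> {w}\<close>: if a column lies inside \<open>A\<close>, then row \<open>w\<close> is split, and if a column avoids \<open>A\<close>,
  then row \<open>v\<close> is. There are at most \<open>c\<close> columns of each kind, and a split row contributes at least
  \<open>\<lambda>(G) \<ge> c \<lambda>(H)\<close>.
\<close>

lemma cut_size_cartesian_product_ge:
  assumes G: "multigraph G" and H: "multigraph H" and A: "A \<subseteq> vertices G \<times> vertices H"
    and vw: "v \<in> vertices H" "w \<in> vertices H" "v \<noteq> w"
    and v: "card {u \<in> vertices G. (u, v) \<notin> A} \<le> c"
    and w: "card {u \<in> vertices G. (u, w) \<in> A} \<le> c"
    and c: "c < card (vertices G)" "c * edge_connectivity H \<le> edge_connectivity G"
  shows "card (vertices G) * edge_connectivity H \<le> cut_size (cartesian_product G H) A"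
proof -
  let ?V = "vertices G" and ?W = "vertices H" and ?l = "edge_connectivity H"
  let ?col = "\<lambda>u. ?W \<inter> {v. (u, v) \<in> A}" and ?row = "\<lambda>v. ?V \<inter> {u. (u, v) \<in> A}"
  have fin: "finite ?V" "finite ?W" using G H by (auto intro: multigraphD(1))
  define P where "P = {u \<in> ?V. \<forall>v\<in>?W. (u, v) \<in> A}"
  define Q where "Q = {u \<in> ?V. \<forall>v\<in>?W. (u, v) \<notin> A}"
  have PQ: "P \<inter> Q = {}" "P \<subseteq> ?V" "Q \<subseteq> ?V" using vw by (auto simp: P_def Q_def)
  have finPQ: "finite P" "finite Q" using PQ fin finite_subset by blast+
  have "card P \<le> card {u \<in> ?V. (u, w) \<in> A}" "card Q \<le> card {u \<in> ?V. (u, v) \<notin> A}"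
    using vw fin by (auto simp: P_def Q_def intro!: card_mono)
  with v w have cardPQ: "card P \<le> c" "card Q \<le> c" by linarith+
  have le_lG: "m * ?l \<le> edge_connectivity G" if "m \<le> c" for m
    using that c(2) by (meson le_trans mult_le_mono1)
  \<comment> \<open>A column in \<open>P\<close> makes row \<open>w\<close> of \<open>A\<close>
    nonempty, and at most \<open>c < |V(G)|\<close> of its vertices lie in \<open>A\<close>, so the
    row is split.\<close>
  have row_w: "card P * ?l \<le> cut_size G (?row w)"
  proof (cases "P = {}")
    case False
    have "?row w = {u \<in> ?V. (u, w) \<in> A}" by auto
    then have "?row w \<noteq> ?V" using w c(1) by auto
    moreover have "?row w \<noteq> {}" using False vw by (auto simp: P_def)
    ultimately have "edge_connectivity G \<le> cut_size G (?row w)"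
      by (intro edge_connectivity_le_cut_size[OF G]) auto
    then show ?thesis using le_lG[OF cardPQ(1)] by simp
  qed simp
  have row_v: "card Q * ?l \<le> cut_size G (?row v)"
  proof (cases "Q = {}")
    case False
    have "{u \<in> ?V. (u, v) \<notin> A} \<noteq> ?V" using v c(1) by auto
    then have "?row v \<noteq> {}" by auto
    moreover have "?row v \<noteq> ?V" using False vw by (auto simp: Q_def)
    ultimately have "edge_connectivity G \<le> cut_size G (?row v)"
      by (intro edge_connectivity_le_cut_size[OF G]) auto
    then show ?thesis using le_lG[OF cardPQ(2)] by simp
  qed simp
  have "card (?V - (P \<union> Q)) * ?l = (\<Sum>u\<in>?V - (P \<union> Q). ?l)" by simp
  also have "\<dots> \<le> (\<Sum>u\<in>?V - (P \<union> Q). cut_size H (?col u))"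
    by (intro sum_mono edge_connectivity_le_cut_size[OF H]) (auto simp: P_def Q_def)
  also have "\<dots> \<le> (\<Sum>u\<in>?V. cut_size H (?col u))"
    using fin by (intro sum_mono2) auto
  finally have cols: "card (?V - (P \<union> Q)) * ?l \<le> (\<Sum>u\<in>?V. cut_size H (?col u))" .
  \<comment> \<open>As \<open>v \<noteq> w\<close>, the payments for \<open>P\<close> and
    \<open>Q\<close> come from different rows and add up.\<close>
  have "card P * ?l + card Q * ?l \<le> (\<Sum>x\<in>{w, v}. cut_size G (?row x))"
    using row_v row_w vw(3) by simp
  also have "\<dots> \<le> (\<Sum>x\<in>?W. cut_size G (?row x))"
    using fin vw by (intro sum_mono2) auto
  finally have rows: "card P * ?l + card Q * ?l \<le> (\<Sum>x\<in>?W. cut_size G (?row x))" .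
  have "card ?V = card (?V - (P \<union> Q)) + card (P \<union> Q)"
    using card_Diff_subset[of "P \<union> Q" ?V] card_mono[OF fin(1), of "P \<union> Q"] finPQ PQ(2,3) by simp
  also have "card (P \<union> Q) = card P + card Q"
    using finPQ PQ(1) by (rule card_Un_disjoint)
  finally have "card ?V * ?l = card (?V - (P \<union> Q)) * ?l + (card P * ?l + card Q * ?l)"
    by (simp add: algebra_simps)
  also have "\<dots> \<le> cut_size (cartesian_product G H) A"
    unfolding cut_size_cartesian_product[OF G H A] using cols rows by (rule add_mono)
  finally show ?thesis .
qed

definition row_eggs :: "nat \<Rightarrow> 'a mgraph \<Rightarrow> 'b mgraph \<Rightarrow> ('a \<times> 'b) set set" where
  "row_eggs c G H =
     {(vertices G - X) \<times> {v} | X v. X \<subseteq> vertices G \<and> card X = c \<and> v \<in> vertices H}"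

lemma scramble_row_eggs:
  assumes G: "multigraph G" and H: "multigraph H"
    and c: "c < vertex_connectivity G" "c < card (vertices G)"
  shows "scramble (cartesian_product G H) (row_eggs c G H)"
  unfolding scramble_def
proof (intro conjI ballI)
  have "row_eggs c G H \<subseteq> Pow (vertices G \<times> vertices H)" by (auto simp: row_eggs_def)
  then show "finite (row_eggs c G H)"
    using multigraphD(1)[OF G] multigraphD(1)[OF H] by (meson finite_Pow_iff finite_SigmaI finite_subset)
next
  fix B assume "B \<in> row_eggs c G H"
  then obtain X v where B: "B = (vertices G - X) \<times> {v}" "X \<subseteq> vertices G" "card X = c" "v \<in> vertices H"
    by (auto simp: row_eggs_def)
  then have "X \<subset> vertices G" using c by auto
  then show "B \<noteq> {}" "B \<subseteq> vertices (cartesian_product G H)"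
    "connected_graph (induced_graph (cartesian_product G H) B)"
    using B c connected_induced_row[OF G H B(4) Diff_subset connected_delete_vertices]
    by auto
qed

lemma hitting_number_row_eggs:
  assumes G: "multigraph G" and H: "multigraph H" and c: "c < card (vertices G)"
  shows "enat (Suc c * card (vertices H)) \<le> hitting_number (cartesian_product G H) (row_eggs c G H)"
  unfolding hitting_number_def
proof (rule INF_greatest)
  fix X assume "X \<in> {X. X \<subseteq> vertices (cartesian_product G H) \<and> (\<forall>B\<in>row_eggs c G H. X \<inter> B \<noteq> {})}"
  then have X: "X \<subseteq> vertices G \<times> vertices H" "\<And>B. B \<in> row_eggs c G H \<Longrightarrow> X \<inter> B \<noteq> {}"
    by auto
  have fin: "finite (vertices G)" "finite (vertices H)" using G H by (auto intro: multigraphD(1))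
  have row: "Suc c \<le> card {u. (u, v) \<in> X}" if v: "v \<in> vertices H" for v
  proof (rule ccontr)
    assume "\<not> Suc c \<le> card {u. (u, v) \<in> X}"
    moreover have "{u. (u, v) \<in> X} \<subseteq> vertices G" using X(1) by auto
    \<comment> \<open>A row meeting \<open>X\<close> in at most \<open>c\<close> vertices has them
      all inside some \<open>c\<close>-set \<open>Y\<close>; the egg omitting \<open>Y\<close> is
      missed.\<close>
    ultimately obtain Y where "{u. (u, v) \<in> X} \<subseteq> Y" "Y \<subseteq> vertices G" "card Y = c"
      using exists_subset_between[of "{u. (u, v) \<in> X}" c "vertices G"] c fin by auto
    moreover from this have "X \<inter> ((vertices G - Y) \<times> {v}) \<noteq> {}"
      by (intro X(2)) (use v in \<open>auto simp: row_eggs_def\<close>)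
    ultimately show False by auto
  qed
  have "Suc c * card (vertices H) = (\<Sum>v\<in>vertices H. Suc c)" by simp
  also have "\<dots> \<le> (\<Sum>v\<in>vertices H. card {u. (u, v) \<in> X})"
    using row by (rule sum_mono)
  also have "\<dots> = card (SIGMA v:vertices H. {u. (u, v) \<in> X})"
    using fin X(1) by (intro card_SigmaI[symmetric]) (auto intro: finite_subset[of _ "vertices G"])
  also have "(SIGMA v:vertices H. {u. (u, v) \<in> X}) = prod.swap ` X"
    using X(1) by (force simp: image_iff)
  also have "card (prod.swap ` X) = card X"
    by (intro card_image) simp
  finally show "enat (Suc c * card (vertices H)) \<le> enat (card X)" by simp
qed

text \<open>Two eggs in one row together omit at most \<open>2 * c\<close> of its vertices, fewer
  than it has, so they meet. Eggs separated by \<open>A\<close> therefore lie in distinct rows, as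
  the bound on cuts requires.\<close>

lemma egg_cut_number_row_eggs:
  assumes G: "multigraph G" and H: "multigraph H" and c: "2 * c < card (vertices G)"
    "c * edge_connectivity H \<le> edge_connectivity G"
  shows "enat (card (vertices G) * edge_connectivity H)
    \<le> egg_cut_number (cartesian_product G H) (row_eggs c G H)"
  unfolding egg_cut_number_def
proof (rule INF_greatest)
  let ?P = "cartesian_product G H" and ?S = "row_eggs c G H"
  fix A assume "A \<in> {A. A \<subseteq> vertices ?P \<and> (\<exists>B\<in>?S. B \<subseteq> A) \<and> (\<exists>B\<in>?S. B \<subseteq> vertices ?P - A)}"
  then obtain X v Y w where A: "A \<subseteq> vertices G \<times> vertices H"
    and X: "(vertices G - X) \<times> {v} \<subseteq> A" "X \<subseteq> vertices G" "card X = c" "v \<in> vertices H"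
    and Y: "(vertices G - Y) \<times> {w} \<subseteq> vertices ?P - A" "Y \<subseteq> vertices G" "card Y = c" "w \<in> vertices H"
    unfolding row_eggs_def by auto
  have fin: "finite (vertices G)" using multigraphD(1)[OF G] .
  have "{u \<in> vertices G. (u, v) \<notin> A} \<subseteq> X" "{u \<in> vertices G. (u, w) \<in> A} \<subseteq> Y"
    using X(1) Y(1) by auto
  then have le: "card {u \<in> vertices G. (u, v) \<notin> A} \<le> c" "card {u \<in> vertices G. (u, w) \<in> A} \<le> c"
    using X(2,3) Y(2,3) fin by (metis card_mono finite_subset)+
  have "v \<noteq> w"
  proof
    assume "v = w"
    then have "vertices G = {u \<in> vertices G. (u, v) \<notin> A} \<union> {u \<in> vertices G. (u, w) \<in> A}" by auto
    then have "card (vertices G) \<le> c + c"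
      using le by (metis (no_types, lifting) add_mono card_Un_le le_trans)
    then show False using c by simp
  qed
  then show "enat (card (vertices G) * edge_connectivity H) \<le> enat (cut_size ?P A)"
    using cut_size_cartesian_product_ge[OF G H A X(4) Y(4) _ le _ c(2)] c(1) by simp
qed

theorem scramble_number_cartesian_product_ge:
  assumes G: "multigraph G" and H: "multigraph H"
    and c: "c < vertex_connectivity G" "2 * c < card (vertices G)"
      "c * edge_connectivity H \<le> edge_connectivity G"
  shows "enat (min (Suc c * card (vertices H)) (card (vertices G) * edge_connectivity H))
    \<le> scramble_number (cartesian_product G H)"
proof -
  let ?P = "cartesian_product G H" and ?S = "row_eggs c G H"
  have c': "c < card (vertices G)" using c by simp
  have "enat (min (Suc c * card (vertices H)) (card (vertices G) * edge_connectivity H))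
      \<le> scramble_order ?P ?S"
    unfolding scramble_order_def
    using hitting_number_row_eggs[OF G H c'] egg_cut_number_row_eggs[OF G H c(2,3)]
    by (simp add: min.coboundedI1 min.coboundedI2 flip: min_enat_simps del: mult_Suc)
  also have "\<dots> \<le> scramble_number ?P"
    unfolding scramble_number_def
    using scramble_row_eggs[OF G H c(1) c']
      scramble_orders_finite_nonempty(1)[OF multigraph_cartesian_product[OF G H]]
    by (intro Max_ge) blast+
  finally show ?thesis .
qed

theorem theorem5p10:
  fixes G :: "'a mgraph" and H :: "'b mgraph" and k :: nat
  assumes "multigraph G" and "connected_graph G"
    and "multigraph H" and "connected_graph H"
    and "k \<ge> 1"
    and "k \<le> vertex_connectivity G"
    and "card (vertices G) \<ge> 2 * k - 1"
    and "edge_connectivity G \<ge> (k - 1) * edge_connectivity H"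
  shows
    "(k * card (vertices H) \<le> card (vertices G) * edge_connectivity H \<and> gonality G = k \<longrightarrow>
        scramble_number (cartesian_product G H) = enat (gonality (cartesian_product G H)) \<and>
        gonality (cartesian_product G H) = k * card (vertices H)) \<and>
     (card (vertices G) * edge_connectivity H \<le> k * card (vertices H) \<and>
        gonality H = edge_connectivity H \<longrightarrow>
        scramble_number (cartesian_product G H) = enat (gonality (cartesian_product G H)) \<and>
        gonality (cartesian_product G H) = card (vertices G) * edge_connectivity H)"
proof -
  let ?P = "cartesian_product G H"
  define N where "N = min (k * card (vertices H)) (card (vertices G) * edge_connectivity H)"
  have "vertices ?P \<noteq> {}" using assms(2,4) by (simp add: connected_graph_def)
  then have up: "scramble_number ?P \<le> enat (gonality ?P)"
    by (rule scramble_number_le_gonality[OF multigraph_cartesian_product[OF assms(1,3)]])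
  \<comment> \<open>With \<open>c = k - 1\<close> and \<open>k \<ge> 1\<close>, the condition
    \<open>2 * c < card (vertices G)\<close> is exactly the assumed \<open>2 * k - 1\<close>
    bound.\<close>
  have "enat N \<le> scramble_number ?P"
    using scramble_number_cartesian_product_ge[OF assms(1,3), of "k - 1"] assms(5-8)
    by (simp add: N_def)
  moreover from this up have "N \<le> gonality ?P"
    by (meson enat_ord_simps(1) order_trans)
  \<comment> \<open>\<open>N\<close> bounds the scramble number, hence the gonality, from below. Any
    matching upper bound on the gonality collapses the chain, and each case supplies one from a
    different factor.\<close>
  ultimately have eq: "scramble_number ?P = enat (gonality ?P) \<and> gonality ?P = N"
    if "gonality ?P \<le> N" using that up by (simp add: order_antisym)
  then show ?thesis
    using gonality_cartesian_product_le_left[OF assms(1,3)]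
      gonality_cartesian_product_le_right[OF assms(1,3)]
    by (intro conjI impI; elim conjE; metis N_def min_absorb1 min_absorb2)
qed

end
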